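(* Let $H$ be a real Hilbert space, identified with its dual by the Riesz map, let $g(x)=\frac12\|x\|^2$ on $H$, and let $C\subset H$ be nonempty, closed and convex. Then the normalized duality mapping and its inverse satisfy $J=J_*=I$, and $\nabla g=I$, $D_g(x,y)=\frac12\|x-y\|^2$. Let $\{\Theta_l\}_{l\ge1}$ be a countable family of equilibrium bifunctions $C\times C\to\mathbb R$, let $\{A_k\}_{k\ge1}$ be a countable family of norm-continuous monotone mappings $C\to H$, and let $\{T_j\}_{j\ge1}$ be a countable family of $J_*$-closed generalized Bregman $J_*$-nonexpansive mappings (for this $g$) from $C$ into $H$. Assume that for all $l,k\ge1$, $x\in C$, $r>0$ the sets $\mathcal Z_r^{\Theta_l}(x)$ and $\mathcal W_r^{A_k}(x)$ are nonempty, and that $$\mathcal S:=\Big(\bigcap_{j\ge1}\{p\in C:T_jp=p\}\Big)\cap\Big(\bigcap_{l\ge1}\operatorname{EP}(\Theta_l)\Big)\cap\Big(\bigcap_{k\ge1}\operatorname{VI}(C,A_k)\Big)\neq\emptyset.$$ Let $\alpha_1,\alpha_2,\alpha_3\in(0,1)$ with $\alpha_1+\alpha_2+\alpha_3=1$, let $r_0>0$, $\{r_n\}\subset[r_0,\infty)$, and let $\tau_T,\tau_A,\tau_\Theta:\mathbb N\to\mathbb N$ each take every value in $\mathbb N$ infinitely often. Then, for $x\in C$, $x_1=x$, $C_1=C$, the general Bregman algorithm (recalled in the context) becomes, for $n\ge1$, $$\begin{cases} z_n=R_{r_n}^{\Theta_{\tau_\Theta(n)}}x_n,\\ u_n=Q_{r_n}^{A_{\tau_A(n)}}x_n,\\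 y_n=\alpha_1x_n+\alpha_2z_n+\alpha_3T_{\tau_T(n)}u_n,\\ C_{n+1}=\{z\in C_n:\|z-y_n\|\le\|z-x_n\|\},\\ x_{n+1}=P_{C_{n+1}}x,\end{cases}$$ and $\{x_n\}$ converges strongly to $P_{\mathcal S}x$.
   Context: $P_D$ denotes the metric projection onto a nonempty closed convex set $D\subset H$. General Bregman algorithm: with $D_g(x,y)=g(x)-g(y)-\langle\nabla g(y),x-y\rangle$ and $P^g_Dx$ the unique minimizer of $D_g(\cdot,x)$ over $D$: $z_n=R_{r_n}^{\Theta_{\tau_\Theta(n)}}x_n$, $u_n=Q_{r_n}^{A_{\tau_A(n)}}x_n$, $y_n=\nabla g^*(\alpha_1\nabla g(x_n)+\alpha_2\nabla g(z_n)+\alpha_3\nabla g(J_*T_{\tau_T(n)}u_n))$, $C_{n+1}=\{z\in C_n:D_g(z,y_n)\le D_g(z,x_n)\}$, $x_{n+1}=P^g_{C_{n+1}}x$. Mappings. For this $g$ and $J_*=I$: $T:C\to H$ is generalized Bregman $J_*$-nonexpansive if $T(C)\subset C$, its fixed point set $\{p\in C:Tp=p\}$ is nonempty, and $\|p-Tx\|\le\|p-x\|$ for all $x\in C$ and all $p\in C$ with $Tp=p$. $T$ is $J_*$-closed if $T(C)\subset C$ and whenever $x_n\to x$ in $C$ and $Tx_n\to y$, then $y=Tx$. An equilibrium bifunction is $\Theta:C\times C\to\mathbb R$ with $\Theta(x,x)=0$; $\Theta(x,y)+\Theta(y,x)\le0$; $\limsup_{t\downarrow0}\Theta(tz+(1-t)x,y)\le\Theta(x,y)$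 (for all $x,y,z\in C$); and $\Theta(x,\cdot)$ convex and lower semicontinuous on $C$ for each $x\in C$. $\operatorname{EP}(\Theta)=\{x^*\in C:\Theta(x^*,y)\ge0\ \forall y\in C\}$; $\operatorname{VI}(C,A)=\{x^*\in C:\langle y-x^*,Ax^*\rangle\ge0\ \forall y\in C\}$. Resolvents. For $r>0$, $x\in C$: $\mathcal Z_r^\Theta(x)=\{z\in C:\Theta(z,y)+\frac1r\langle y-z,z-x\rangle\ge0\ \forall y\in C\}$, $\mathcal W_r^A(x)=\{z\in C:\langle y-z,Az\rangle+\frac1r\langle y-z,z-x\rangle\ge0\ \forall y\in C\}$. When nonempty (for $\Theta$ an equilibrium bifunction, $A$ monotone) these sets are singletons, whose unique elements are denoted $R_r^\Theta x$ and $Q_r^Ax$. *)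

theory Defs
  imports "HOL-Analysis.Analysis"
begin

text \<open>
  The topological dual of a space \<open>'a\<close> is the type \<open>'a \<Rightarrow>\<^sub>L real\<close>. In a Hilbert space, which is a type
  of class \<open>real_inner\<close> and \<open>complete_space\<close>, the Riesz map is \<^const>\<open>blinfun_inner_right\<close>.
  All sequences and countable families are indexed by the positive natural numbers; the values at
  index \<open>0\<close> are irrelevant.
\<close>

abbreviation riesz :: "'a::real_inner \<Rightarrow> 'a \<Rightarrow>\<^sub>L real"
  where "riesz \<equiv> blinfun_inner_right"

definition duality_map :: "'a::real_normed_vector \<Rightarrow> ('a \<Rightarrow>\<^sub>L real) set"
  where "duality_map x = {f. blinfun_apply f x = (norm x)\<^sup>2 \<and> norm f = norm x}"

definition inv_duality_map :: "('a::real_normed_vector \<Rightarrow>\<^sub>L real) \<Rightarrow> 'a"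
  where "inv_duality_map f = (THE x. f \<in> duality_map x)"

definition half_norm_sq :: "'a::real_normed_vector \<Rightarrow> real"
  where "half_norm_sq x = (norm x)\<^sup>2 / 2"

definition grad :: "('a::real_normed_vector \<Rightarrow> real) \<Rightarrow> 'a \<Rightarrow> 'a \<Rightarrow>\<^sub>L real"
  where "grad g x = (THE f. (g has_derivative blinfun_apply f) (at x))"

text \<open>The Fenchel conjugate. The supremum is taken in the reals, so it is meaningful only for those
  \<open>g\<close> whose conjugate is finite everywhere, such as \<^const>\<open>half_norm_sq\<close>.\<close>

definition conjugate :: "('a::real_normed_vector \<Rightarrow> real) \<Rightarrow> ('a \<Rightarrow>\<^sub>L real) \<Rightarrow> real"
  where "conjugate g f = (SUP x. blinfun_apply f x - g x)"

text \<open>The gradient of a function on the dual of a reflexive space: the derivative, an element of the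
  bidual, is identified with the vector at which it evaluates.\<close>

definition dual_grad :: "(('a::real_normed_vector \<Rightarrow>\<^sub>L real) \<Rightarrow> real) \<Rightarrow> ('a \<Rightarrow>\<^sub>L real) \<Rightarrow> 'a"
  where "dual_grad h f = (THE v. (h has_derivative (\<lambda>k. blinfun_apply k v)) (at f))"

definition bregman_dist :: "('a::real_normed_vector \<Rightarrow> real) \<Rightarrow> 'a \<Rightarrow> 'a \<Rightarrow> real"
  where "bregman_dist g x y = g x - g y - blinfun_apply (grad g y) (x - y)"

definition bregman_proj :: "('a::real_normed_vector \<Rightarrow> real) \<Rightarrow> 'a set \<Rightarrow> 'a \<Rightarrow> 'a"
  where "bregman_proj g D x = (THE p. is_arg_min (\<lambda>z. bregman_dist g z x) (\<lambda>z. z \<in> D) p)"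

text \<open>The library's \<^const>\<open>closest_point\<close> requires the class \<open>heine_borel\<close> and hence finite dimension.\<close>

definition metric_proj :: "'a::real_normed_vector set \<Rightarrow> 'a \<Rightarrow> 'a"
  where "metric_proj D x = (THE p. is_arg_min (\<lambda>z. norm (x - z)) (\<lambda>z. z \<in> D) p)"

definition fixed_points :: "'a set \<Rightarrow> ('a \<Rightarrow> 'a) \<Rightarrow> 'a set"
  where "fixed_points C T = {p \<in> C. T p = p}"

text \<open>The notions of generalized Bregman \<open>J\<^sub>*\<close>-nonexpansive and of \<open>J\<^sub>*\<close>-closed mappings, in the form
  they take for \<open>g = half_norm_sq\<close> and \<open>J\<^sub>* = I\<close>.\<close>

definition bregman_nonexpansive :: "'a::real_normed_vector set \<Rightarrow> ('a \<Rightarrow> 'a) \<Rightarrow> bool"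
  where "bregman_nonexpansive C T \<longleftrightarrow>
    T ` C \<subseteq> C \<and> fixed_points C T \<noteq> {} \<and>
    (\<forall>x\<in>C. \<forall>p\<in>fixed_points C T. norm (p - T x) \<le> norm (p - x))"

definition J_closed :: "'a::real_normed_vector set \<Rightarrow> ('a \<Rightarrow> 'a) \<Rightarrow> bool"
  where "J_closed C T \<longleftrightarrow>
    T ` C \<subseteq> C \<and>
    (\<forall>s x y. (\<forall>n. s n \<in> C) \<and> x \<in> C \<and> s \<longlonglongrightarrow> x \<and> (\<lambda>n. T (s n)) \<longlonglongrightarrow> y \<longrightarrow> y = T x)"

definition lsc_on :: "'a::topological_space set \<Rightarrow> ('a \<Rightarrow> real) \<Rightarrow> bool"
  where "lsc_on C f \<longleftrightarrow> (\<forall>x\<in>C. ereal (f x) \<le> Liminf (at x within C) (\<lambda>y. ereal (f y)))"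

definition equilibrium_bifunction ::
    "'a::real_normed_vector set \<Rightarrow> ('a \<Rightarrow> 'a \<Rightarrow> real) \<Rightarrow> bool"
  where "equilibrium_bifunction C \<Theta> \<longleftrightarrow>
    (\<forall>x\<in>C. \<Theta> x x = 0) \<and>
    (\<forall>x\<in>C. \<forall>y\<in>C. \<Theta> x y + \<Theta> y x \<le> 0) \<and>
    (\<forall>x\<in>C. \<forall>y\<in>C. \<forall>z\<in>C.
       Limsup (at_right 0) (\<lambda>t. ereal (\<Theta> (t *\<^sub>R z + (1 - t) *\<^sub>R x) y)) \<le> ereal (\<Theta> x y)) \<and>
    (\<forall>x\<in>C. convex_on C (\<Theta> x) \<and> lsc_on C (\<Theta> x))"

definition EP :: "'a set \<Rightarrow> ('a \<Rightarrow> 'a \<Rightarrow> real) \<Rightarrow> 'a set"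
  where "EP C \<Theta> = {x \<in> C. \<forall>y\<in>C. \<Theta> x y \<ge> 0}"

definition VI :: "'a::real_inner set \<Rightarrow> ('a \<Rightarrow> 'a) \<Rightarrow> 'a set"
  where "VI C A = {x \<in> C. \<forall>y\<in>C. inner (y - x) (A x) \<ge> 0}"

definition monotone_operator :: "'a::real_inner set \<Rightarrow> ('a \<Rightarrow> 'a) \<Rightarrow> bool"
  where "monotone_operator C A \<longleftrightarrow> (\<forall>x\<in>C. \<forall>y\<in>C. inner (x - y) (A x - A y) \<ge> 0)"

definition EP_resolvent_set ::
    "'a::real_inner set \<Rightarrow> ('a \<Rightarrow> 'a \<Rightarrow> real) \<Rightarrow> real \<Rightarrow> 'a \<Rightarrow> 'a set"
  where "EP_resolvent_set C \<Theta> r x =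
    {z \<in> C. \<forall>y\<in>C. \<Theta> z y + (1 / r) * inner (y - z) (z - x) \<ge> 0}"

definition VI_resolvent_set ::
    "'a::real_inner set \<Rightarrow> ('a \<Rightarrow> 'a) \<Rightarrow> real \<Rightarrow> 'a \<Rightarrow> 'a set"
  where "VI_resolvent_set C A r x =
    {z \<in> C. \<forall>y\<in>C. inner (y - z) (A z) + (1 / r) * inner (y - z) (z - x) \<ge> 0}"

definition EP_resolvent :: "'a::real_inner set \<Rightarrow> ('a \<Rightarrow> 'a \<Rightarrow> real) \<Rightarrow> real \<Rightarrow> 'a \<Rightarrow> 'a"
  where "EP_resolvent C \<Theta> r x = (THE z. z \<in> EP_resolvent_set C \<Theta> r x)"

definition VI_resolvent :: "'a::real_inner set \<Rightarrow> ('a \<Rightarrow> 'a) \<Rightarrow> real \<Rightarrow> 'a \<Rightarrow> 'a"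
  where "VI_resolvent C A r x = (THE z. z \<in> VI_resolvent_set C A r x)"

definition takes_all_values_infinitely_often :: "(nat \<Rightarrow> nat) \<Rightarrow> bool"
  where "takes_all_values_infinitely_often \<tau> \<longleftrightarrow>
    (\<forall>n\<ge>1. \<tau> n \<ge> 1) \<and> (\<forall>k\<ge>1. infinite {n. n \<ge> 1 \<and> \<tau> n = k})"

text \<open>The general algorithm, for mappings \<open>T j\<close> with values in the dual space.\<close>

definition bregman_algorithm ::
    "('a::real_inner \<Rightarrow> real) \<Rightarrow> 'a set \<Rightarrow> (nat \<Rightarrow> 'a \<Rightarrow> 'a \<Rightarrow> real) \<Rightarrow> (nat \<Rightarrow> 'a \<Rightarrow> 'a) \<Rightarrow>
     (nat \<Rightarrow> 'a \<Rightarrow> 'a \<Rightarrow>\<^sub>L real) \<Rightarrow> (nat \<Rightarrow> nat) \<Rightarrow> (nat \<Rightarrow> nat) \<Rightarrow> (nat \<Rightarrow> nat) \<Rightarrow>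
     real \<Rightarrow> real \<Rightarrow> real \<Rightarrow> (nat \<Rightarrow> real) \<Rightarrow> 'a \<Rightarrow>
     (nat \<Rightarrow> 'a) \<Rightarrow> (nat \<Rightarrow> 'a) \<Rightarrow> (nat \<Rightarrow> 'a) \<Rightarrow> (nat \<Rightarrow> 'a) \<Rightarrow> (nat \<Rightarrow> 'a set) \<Rightarrow> bool"
  where "bregman_algorithm g C \<Theta> A T \<tau>\<Theta> \<tau>A \<tau>T \<alpha>1 \<alpha>2 \<alpha>3 r x X Z U Y D \<longleftrightarrow>
    X 1 = x \<and> D 1 = C \<and>
    (\<forall>n\<ge>1.
      Z n = EP_resolvent C (\<Theta> (\<tau>\<Theta> n)) (r n) (X n) \<and>
      U n = VI_resolvent C (A (\<tau>A n)) (r n) (X n) \<and>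
      Y n = dual_grad (conjugate g)
              (\<alpha>1 *\<^sub>R grad g (X n) + \<alpha>2 *\<^sub>R grad g (Z n) +
               \<alpha>3 *\<^sub>R grad g (inv_duality_map (T (\<tau>T n) (U n)))) \<and>
      D (Suc n) = {z \<in> D n. bregman_dist g z (Y n) \<le> bregman_dist g z (X n)} \<and>
      X (Suc n) = bregman_proj g (D (Suc n)) x)"

definition hilbert_algorithm ::
    "'a::real_inner set \<Rightarrow> (nat \<Rightarrow> 'a \<Rightarrow> 'a \<Rightarrow> real) \<Rightarrow> (nat \<Rightarrow> 'a \<Rightarrow> 'a) \<Rightarrow>
     (nat \<Rightarrow> 'a \<Rightarrow> 'a) \<Rightarrow> (nat \<Rightarrow> nat) \<Rightarrow> (nat \<Rightarrow> nat) \<Rightarrow> (nat \<Rightarrow> nat) \<Rightarrow>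
     real \<Rightarrow> real \<Rightarrow> real \<Rightarrow> (nat \<Rightarrow> real) \<Rightarrow> 'a \<Rightarrow>
     (nat \<Rightarrow> 'a) \<Rightarrow> (nat \<Rightarrow> 'a) \<Rightarrow> (nat \<Rightarrow> 'a) \<Rightarrow> (nat \<Rightarrow> 'a) \<Rightarrow> (nat \<Rightarrow> 'a set) \<Rightarrow> bool"
  where "hilbert_algorithm C \<Theta> A T \<tau>\<Theta> \<tau>A \<tau>T \<alpha>1 \<alpha>2 \<alpha>3 r x X Z U Y D \<longleftrightarrow>
    X 1 = x \<and> D 1 = C \<and>
    (\<forall>n\<ge>1.
      Z n = EP_resolvent C (\<Theta> (\<tau>\<Theta> n)) (r n) (X n) \<and>
      U n = VI_resolvent C (A (\<tau>A n)) (r n) (X n) \<and>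
      Y n = \<alpha>1 *\<^sub>R X n + \<alpha>2 *\<^sub>R Z n + \<alpha>3 *\<^sub>R T (\<tau>T n) (U n) \<and>
      D (Suc n) = {z \<in> D n. norm (z - Y n) \<le> norm (z - X n)} \<and>
      X (Suc n) = metric_proj (D (Suc n)) x)"

end

theory Submission
  imports Defs
begin

text \<open>
  Every point \<open>p\<close> of \<open>S\<close> satisfies
  \<open>\<parallel>p - y\<^sub>n\<parallel>\<^sup>2 + \<alpha>2 \<parallel>z\<^sub>n - x\<^sub>n\<parallel>\<^sup>2 + \<alpha>3 \<parallel>u\<^sub>n - x\<^sub>n\<parallel>\<^sup>2 \<le> \<parallel>p - x\<^sub>n\<parallel>\<^sup>2\<close>,
  so \<open>S\<close> lies in every \<open>C\<^sub>n\<close>. As \<open>x\<^sub>n\<close> is the projection of \<open>x\<close> onto the decreasing sets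
  \<open>C\<^sub>n\<close>, the distances \<open>\<parallel>x\<^sub>n - x\<parallel>\<close> increase and stay below \<open>\<parallel>p - x\<parallel>\<close>, and the Pythagorean inequality
  makes \<open>x\<^sub>n\<close> Cauchy. From \<open>x\<^bsub>n+1\<^esub> \<in> C\<^bsub>n+1\<^esub>\<close> the \<open>y\<^sub>n\<close> have the same limit, hence by the
  displayed inequality so do \<open>z\<^sub>n\<close>, \<open>u\<^sub>n\<close> and \<open>T u\<^sub>n\<close>. Along the subsequence where a given index
  recurs, the limit solves the corresponding fixed point or equilibrium problem; it is therefore in
  \<open>S\<close>, and no point of \<open>S\<close> is closer to \<open>x\<close>.
\<close>

subsection \<open>Metric projections\<close>

text \<open>Parallelogram law for \<open>x - u\<close> and \<open>x - v\<close>, whose sum is twice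
  the difference of \<open>x\<close> and the midpoint. It forces near-minimizers of the distance to
  lie close together.\<close>

lemma norm_midpoint_parallelogram:
  fixes x u v :: "'a::real_inner"
  shows "(norm (u - v))\<^sup>2 = 2 * (norm (x - u))\<^sup>2 + 2 * (norm (x - v))\<^sup>2
    - 4 * (norm (x - ((1/2) *\<^sub>R u + (1/2) *\<^sub>R v)))\<^sup>2"
  unfolding power2_norm_eq_inner
  by (simp add: inner_diff inner_add inner_commute algebra_simps)

text \<open>The sets of near-minimizers are nested, closed and of vanishing diameter, so
  completeness yields a common point.\<close>

lemma metric_proj_exists:
  fixes D :: "'a::{real_inner, complete_space} set"
  assumes "closed D" "convex D" "D \<noteq> {}"
  shows "\<exists>p\<in>D. \<forall>z\<in>D. norm (x - p) \<le> norm (x - z)"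
proof -
  define d where "d = (INF z\<in>D. (norm (x - z))\<^sup>2)"
  have d_le: "d \<le> (norm (x - z))\<^sup>2" if "z \<in> D" for z
    unfolding d_def by (rule cINF_lower[OF _ that]) (auto intro!: bdd_belowI[of _ 0])
  define E where "E n = {z \<in> D. (norm (x - z))\<^sup>2 \<le> d + inverse (real (Suc n))}" for n
  have "\<exists>a. \<Inter>(range E) = {a}"
  proof (rule decreasing_closed_nest_sing)
    have "E n = D \<inter> {z. (norm (x - z))\<^sup>2 \<le> d + inverse (real (Suc n))}" for n
      by (auto simp: E_def)
    then show "closed (E n)" for n
      using assms(1) by (auto intro!: closed_Int closed_Collect_le continuous_intros)
    show "E n \<noteq> {}" for n
    proof -
      have "d < d + inverse (real (Suc n))" by simp
      then obtain z where "z \<in> D" "(norm (x - z))\<^sup>2 < d + inverse (real (Suc n))"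
        using assms(3) unfolding d_def by (subst (asm) cINF_less_iff) (auto intro!: bdd_belowI[of _ 0])
      then show ?thesis by (auto simp: E_def)
    qed
    show "E n \<subseteq> E m" if "m \<le> n" for m n
    proof -
      have "inverse (real (Suc n)) \<le> inverse (real (Suc m))" using that by simp
      then show ?thesis using order_trans[OF _ add_left_mono] unfolding E_def by blast
    qed
    show "\<exists>n. \<forall>u\<in>E n. \<forall>v\<in>E n. dist u v < \<epsilon>" if "\<epsilon> > 0" for \<epsilon> :: real
    proof -
      \<comment> \<open>With tolerance \<open>\<delta>\<close>, the squared distances of
        \<open>u\<close> and \<open>v\<close> are at most \<open>d + \<delta>\<close> and that of
        the midpoint is at least \<open>d\<close>; the parallelogram law leaves at most
        \<open>4 * \<delta>\<close>.\<close>
      obtain n where n: "inverse (real (Suc n)) < \<epsilon>\<^sup>2 / 4"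
        using reals_Archimedean[of "\<epsilon>\<^sup>2 / 4"] \<open>\<epsilon> > 0\<close> by auto
      have "dist u v < \<epsilon>" if uv: "u \<in> E n" "v \<in> E n" for u v
      proof -
        have "(1/2) *\<^sub>R u + (1/2) *\<^sub>R v \<in> D"
          using uv by (intro convexD[OF assms(2)]) (auto simp: E_def)
        then have "(norm (u - v))\<^sup>2 < \<epsilon>\<^sup>2"
          using d_le[of "(1/2) *\<^sub>R u + (1/2) *\<^sub>R v"] uv n
            norm_midpoint_parallelogram[of u v x] by (auto simp: E_def)
        then show ?thesis using \<open>\<epsilon> > 0\<close> by (simp add: dist_norm power2_less_imp_less)
      qed
      then show ?thesis by blast
    qed
  qed
  then obtain p where p: "\<And>n. p \<in> E n" by blast
  have "(norm (x - p))\<^sup>2 \<le> d"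
  proof (rule LIMSEQ_le_const)
    show "(\<lambda>n. d + inverse (real (Suc n))) \<longlonglongrightarrow> d"
      using tendsto_add[OF tendsto_const LIMSEQ_inverse_real_of_nat, of d] by simp
  qed (use p in \<open>auto simp: E_def\<close>)
  then have "norm (x - p) \<le> norm (x - z)" if "z \<in> D" for z
    using d_le[OF that] by (meson norm_ge_zero order_trans power2_le_imp_le)
  then show ?thesis using p by (auto simp: E_def)
qed

lemma metric_proj_ex1:
  fixes D :: "'a::{real_inner, complete_space} set"
  assumes "closed D" "convex D" "D \<noteq> {}"
  shows "\<exists>!p. is_arg_min (\<lambda>z. norm (x - z)) (\<lambda>z. z \<in> D) p"
proof -
  obtain p where p: "p \<in> D" "\<forall>z\<in>D. norm (x - p) \<le> norm (x - z)"
    using metric_proj_exists[OF assms] by blast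
  show ?thesis
  proof (rule ex1I)
    show "is_arg_min (\<lambda>z. norm (x - z)) (\<lambda>z. z \<in> D) p"
      using p by (simp add: is_arg_min_linorder)
    show "q = p" if "is_arg_min (\<lambda>z. norm (x - z)) (\<lambda>z. z \<in> D) q" for q
      using that p any_closest_point_unique[OF assms(2,1), of q p x]
      by (simp add: is_arg_min_linorder dist_norm)
  qed
qed

lemma metric_proj_arg_min:
  fixes D :: "'a::{real_inner, complete_space} set"
  assumes "closed D" "convex D" "D \<noteq> {}"
  shows "metric_proj D x \<in> D" "z \<in> D \<Longrightarrow> norm (x - metric_proj D x) \<le> norm (x - z)"
  using theI'[OF metric_proj_ex1[OF assms, of x]]
  by (auto simp: metric_proj_def is_arg_min_linorder)

lemma metric_proj_eqI:
  fixes D :: "'a::{real_inner, complete_space} set"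
  assumes "closed D" "convex D" "p \<in> D" "\<And>z. z \<in> D \<Longrightarrow> norm (x - p) \<le> norm (x - z)"
  shows "metric_proj D x = p"
  unfolding metric_proj_def
  using metric_proj_ex1[OF assms(1,2), of x] assms(3,4)
  by (intro the1_equality) (auto simp: is_arg_min_linorder)

lemma metric_proj_inner_le:
  fixes D :: "'a::{real_inner, complete_space} set"
  assumes "closed D" "convex D" "z \<in> D"
  shows "inner (x - metric_proj D x) (z - metric_proj D x) \<le> 0"
  using assms metric_proj_arg_min[OF assms(1,2)]
  by (intro any_closest_point_dot[OF assms(2,1)]) (auto simp: dist_norm)

text \<open>Expand \<open>z - x\<close> at the projection; the obtuse angle inequality gives the
  sign of the cross term.\<close>

lemma metric_proj_pythagoras:
  fixes D :: "'a::{real_inner, complete_space} set"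
  assumes "closed D" "convex D" "z \<in> D"
  shows "(norm (metric_proj D x - x))\<^sup>2 + (norm (z - metric_proj D x))\<^sup>2 \<le> (norm (z - x))\<^sup>2"
  using metric_proj_inner_le[OF assms, of x] unfolding power2_norm_eq_inner
  by (simp add: inner_diff inner_commute algebra_simps)

text \<open>Squaring cancels \<open>inner z z\<close> and leaves an affine inequality, so each cut
  of \<open>D n\<close> preserves closedness and convexity.\<close>

lemma bisector_halfspace:
  fixes a b :: "'a::real_inner"
  shows "{z. norm (z - a) \<le> norm (z - b)} = {z. inner (b - a) z \<le> (inner b b - inner a a) / 2}"
  by (auto simp: norm_le inner_diff inner_commute algebra_simps)

lemma closed_convex_bisector:
  fixes a b :: "'a::real_inner"
  assumes "closed D" "convex D"
  shows "closed {z \<in> D. norm (z - a) \<le> norm (z - b)}"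
    and "convex {z \<in> D. norm (z - a) \<le> norm (z - b)}"
  unfolding Collect_conj_eq Collect_mem_eq bisector_halfspace
  using assms closed_halfspace_le convex_halfspace_le by (blast intro: closed_Int convex_Int)+

subsection \<open>Duality in Hilbert space\<close>

lemma riesz_inject [simp]: "riesz v = riesz w \<longleftrightarrow> v = w"
  by (metis blinfun_inner_right.rep_eq inner_commute vector_eq_ldot)

lemma norm_riesz [simp]: "norm (riesz v) = norm v"
proof (rule antisym)
  show "norm (riesz v) \<le> norm v"
    by (rule norm_blinfun_bound) (auto simp: Cauchy_Schwarz_ineq2)
  have "norm v * norm v \<le> norm (riesz v) * norm v"
    using norm_blinfun[of "riesz v" v] by (simp add: dot_square_norm power2_eq_square)
  then show "norm v \<le> norm (riesz v)"
    by (cases "v = 0") auto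
qed

lemma riesz_linear:
  "riesz (v + w) = riesz v + riesz w" "riesz (v - w) = riesz v - riesz w"
  "riesz (c *\<^sub>R v) = c *\<^sub>R riesz v"
  by (auto intro!: blinfun_eqI simp: inner_simps blinfun.bilinear_simps)

text \<open>The representing vector is the multiple of the least-norm point of the hyperplane
  \<open>f = 1\<close>.\<close>

lemma riesz_surj:
  fixes f :: "'a::{real_inner, complete_space} \<Rightarrow>\<^sub>L real"
  obtains v where "f = riesz v"
proof (cases "f = 0")
  case True
  then have "f = riesz 0" by (auto intro!: blinfun_eqI)
  then show ?thesis by (rule that)
next
  case False
  then obtain u where u: "f u \<noteq> 0" by (metis blinfun_eqI zero_blinfun.rep_eq)
  define D where "D = {z. f z = 1}"
  have D: "closed D" "convex D"
    by (auto simp: D_def convex_def blinfun.bilinear_simps intro!: closed_Collect_eq continuous_intros)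
  have "D \<noteq> {}"
    using u by (auto simp: D_def blinfun.bilinear_simps intro!: exI[of _ "(1 / f u) *\<^sub>R u"])
  define p where "p = metric_proj D 0"
  have p: "f p = 1"
    using metric_proj_arg_min(1)[OF D \<open>D \<noteq> {}\<close>, of 0] by (simp add: p_def D_def)
  \<comment> \<open>For \<open>w\<close> in the kernel of \<open>f\<close>, \<open>p + w\<close>
    stays in the hyperplane, so the obtuse angle inequality at \<open>p\<close> applies; replacing
    \<open>w\<close> by \<open>- w\<close> then gives orthogonality.\<close>
  have nonneg: "inner p w \<ge> 0" if "f w = 0" for w
    using metric_proj_inner_le[OF D, of "p + w" 0] that p
    by (simp add: D_def p_def blinfun.bilinear_simps)
  have orth: "inner p w = 0" if "f w = 0" for w
    using nonneg[of w] nonneg[of "- w"] that by (simp add: blinfun.bilinear_simps)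
  have "p \<noteq> 0" using p by auto
  \<comment> \<open>\<open>z - f z *\<^sub>R p\<close> lies in the kernel because
    \<open>f p = 1\<close>.\<close>
  have "f z = inner ((1 / inner p p) *\<^sub>R p) z" for z
    using orth[of "z - f z *\<^sub>R p"] p \<open>p \<noteq> 0\<close>
    by (simp add: blinfun.bilinear_simps inner_diff_right)
  then have "f = riesz ((1 / inner p p) *\<^sub>R p)" by (auto intro!: blinfun_eqI)
  then show ?thesis by (rule that)
qed

text \<open>With \<open>f = riesz w\<close>, the two conditions say
  \<open>inner w v = (norm v)\<^sup>2 = (norm w)\<^sup>2\<close>, the equality case of
  Cauchy-Schwarz, hence \<open>w = v\<close>.\<close>

lemma duality_map_hilbert:
  fixes v :: "'a::{real_inner, complete_space}"
  shows "duality_map v = {riesz v}"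
proof -
  have "f = riesz v" if f: "blinfun_apply f v = (norm v)\<^sup>2" "norm f = norm v" for f
  proof -
    obtain w where w: "f = riesz w" by (rule riesz_surj)
    have "(norm w)\<^sup>2 = (norm v)\<^sup>2" using f w by simp
    then have "(norm (w - v))\<^sup>2 = 0"
      using f w unfolding power2_norm_eq_inner by (simp add: inner_diff inner_commute)
    then show ?thesis using w by simp
  qed
  then show ?thesis by (auto simp: duality_map_def dot_square_norm)
qed

lemma inv_duality_map_riesz:
  fixes v :: "'a::{real_inner, complete_space}"
  shows "inv_duality_map (riesz v) = v"
  by (simp add: inv_duality_map_def duality_map_hilbert)

section \<open>Gradient, Bregman distance and conjugate of half the squared norm\<close>

lemma grad_half_norm_sq:
  fixes v :: "'a::real_inner"
  shows "grad half_norm_sq v = riesz v"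
  unfolding grad_def
proof (rule the_equality)
  have "((\<lambda>z. inner z z / 2) has_derivative blinfun_apply (riesz v)) (at v)"
    by (auto intro!: derivative_eq_intros simp: inner_commute)
  then show *: "(half_norm_sq has_derivative blinfun_apply (riesz v)) (at v)"
    by (simp add: half_norm_sq_def[abs_def] power2_norm_eq_inner)
  show "f = riesz v" if "(half_norm_sq has_derivative blinfun_apply f) (at v)" for f
    using has_derivative_unique[OF that *] by (intro blinfun_eqI) simp
qed

lemma bregman_dist_half_norm_sq:
  fixes v w :: "'a::real_inner"
  shows "bregman_dist half_norm_sq v w = (norm (v - w))\<^sup>2 / 2"
  unfolding bregman_dist_def grad_half_norm_sq half_norm_sq_def power2_norm_eq_inner
  by (simp add: inner_diff inner_commute field_simps)

text \<open>Completing the square: the expression at \<open>z\<close> falls short of the value by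
  \<open>(norm (v - z))\<^sup>2 / 2\<close>, so the supremum is attained at
  \<open>v\<close>.\<close>

lemma conjugate_half_norm_sq:
  fixes v :: "'a::real_inner"
  shows "conjugate half_norm_sq (riesz v) = (norm v)\<^sup>2 / 2"
  unfolding conjugate_def
proof (rule cSup_eq_maximum)
  show "(norm v)\<^sup>2 / 2 \<in> range (\<lambda>x. blinfun_apply (riesz v) x - half_norm_sq x)"
    by (rule image_eqI[of _ _ v]) (auto simp: half_norm_sq_def dot_square_norm)
  show "y \<le> (norm v)\<^sup>2 / 2" if y: "y \<in> range (\<lambda>x. blinfun_apply (riesz v) x - half_norm_sq x)" for y
  proof -
    obtain z where z: "y = inner v z - (norm z)\<^sup>2 / 2"
      using y by (auto simp: half_norm_sq_def)
    have "0 \<le> (norm (v - z))\<^sup>2" by simp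
    then show ?thesis
      unfolding z power2_norm_eq_inner by (simp add: inner_diff inner_commute)
  qed
qed

text \<open>Every functional is some \<open>riesz w\<close>, and the first-order remainder of the
  conjugate is exactly \<open>(norm (w - v))\<^sup>2 / 2\<close>.\<close>

lemma dual_grad_conjugate_half_norm_sq:
  fixes v :: "'a::{real_inner, complete_space}"
  shows "dual_grad (conjugate half_norm_sq) (riesz v) = v"
  unfolding dual_grad_def
proof (rule the_equality)
  let ?h = "conjugate half_norm_sq :: ('a \<Rightarrow>\<^sub>L real) \<Rightarrow> real"
  show *: "(?h has_derivative (\<lambda>k. blinfun_apply k v)) (at (riesz v))"
    unfolding has_derivative_at_alt
  proof (intro conjI allI impI)
    show "bounded_linear (\<lambda>k. blinfun_apply k v)" by (rule blinfun.bounded_linear_left)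
    fix e :: real assume "e > 0"
    \<comment> \<open>Half a squared distance is at most \<open>e\<close> times the distance within
      radius \<open>2 * e\<close>.\<close>
    have "norm (?h f - ?h (riesz v) - blinfun_apply (f - riesz v) v) \<le> e * norm (f - riesz v)"
      if "norm (f - riesz v) < 2 * e" for f
    proof -
      obtain w where w: "f = riesz w" by (rule riesz_surj)
      have nrm: "norm (f - riesz v) = norm (w - v)" by (simp add: w flip: riesz_linear)
      have eq: "?h f - ?h (riesz v) - blinfun_apply (f - riesz v) v = (norm (w - v))\<^sup>2 / 2"
        unfolding w conjugate_half_norm_sq blinfun.diff_left power2_norm_eq_inner
        by (simp add: inner_diff inner_commute field_simps)
      have "(norm (w - v))\<^sup>2 / 2 \<le> e * norm (w - v)"
        using that mult_right_mono[of "norm (w - v)" "2 * e" "norm (w - v)"]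
        by (simp add: nrm power2_eq_square)
      then show ?thesis unfolding eq nrm by simp
    qed
    then show "\<exists>d>0. \<forall>f. norm (f - riesz v) < d \<longrightarrow>
        norm (?h f - ?h (riesz v) - blinfun_apply (f - riesz v) v) \<le> e * norm (f - riesz v)"
      using \<open>e > 0\<close> by (intro exI[of _ "2 * e"]) auto
  qed
  show "w = v" if "(?h has_derivative (\<lambda>k. blinfun_apply k w)) (at (riesz v))" for w
  proof -
    have "blinfun_apply (riesz u) w = blinfun_apply (riesz u) v" for u
      using has_derivative_unique[OF that *] by (rule fun_cong)
    then have "\<forall>u. inner u w = inner u v" by simp
    then show ?thesis by (simp only: vector_eq_ldot)
  qed
qed

text \<open>The two minimization predicates agree for every \<open>p\<close>, so the definite
  descriptions coincide whether or not a unique minimizer exists.\<close>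

lemma bregman_proj_half_norm_sq:
  fixes x :: "'a::real_inner"
  shows "bregman_proj half_norm_sq D x = metric_proj D x"
proof -
  have "is_arg_min (\<lambda>z. bregman_dist half_norm_sq z x) (\<lambda>z. z \<in> D) p \<longleftrightarrow>
      is_arg_min (\<lambda>z. norm (x - z)) (\<lambda>z. z \<in> D) p" for p
    by (simp add: is_arg_min_linorder bregman_dist_half_norm_sq norm_minus_commute flip: abs_le_square_iff)
  then show ?thesis by (simp add: bregman_proj_def metric_proj_def)
qed

text \<open>\<open>T j\<close> is composed with \<open>riesz\<close> because the general algorithm
  expects values in the dual; \<open>inv_duality_map\<close> undoes this. Linearity merges the
  gradients into one \<open>riesz\<close> value, which the gradient of the conjugate
  inverts.\<close>

lemma bregman_algorithm_half_norm_sq: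
  fixes C :: "'a::{real_inner, complete_space} set"
  shows "bregman_algorithm half_norm_sq C \<Theta> A (\<lambda>j v. riesz (T j v)) \<tau>\<Theta> \<tau>A \<tau>T \<alpha>1 \<alpha>2 \<alpha>3 r x X Z U Y D
    \<longleftrightarrow> hilbert_algorithm C \<Theta> A T \<tau>\<Theta> \<tau>A \<tau>T \<alpha>1 \<alpha>2 \<alpha>3 r x X Z U Y D"
proof -
  have "bregman_dist half_norm_sq z a \<le> bregman_dist half_norm_sq z b \<longleftrightarrow> norm (z - a) \<le> norm (z - b)"
    for z a b :: 'a
    by (simp add: bregman_dist_half_norm_sq flip: abs_le_square_iff)
  then show ?thesis
    unfolding bregman_algorithm_def hilbert_algorithm_def
    by (simp add: grad_half_norm_sq inv_duality_map_riesz bregman_proj_half_norm_sq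
        dual_grad_conjugate_half_norm_sq flip: riesz_linear)
qed

subsection \<open>Equilibrium problems and their resolvents\<close>

lemma equilibrium_bifunctionD:
  assumes "equilibrium_bifunction C \<Theta>" "x \<in> C"
  shows "\<Theta> x x = 0" "y \<in> C \<Longrightarrow> \<Theta> x y + \<Theta> y x \<le> 0"
    "y \<in> C \<Longrightarrow> z \<in> C \<Longrightarrow>
      Limsup (at_right 0) (\<lambda>t. ereal (\<Theta> (t *\<^sub>R z + (1 - t) *\<^sub>R x) y)) \<le> ereal (\<Theta> x y)"
    "convex_on C (\<Theta> x)" "lsc_on C (\<Theta> x)"
  using assms unfolding equilibrium_bifunction_def by blast+

text \<open>A level \<open>c\<close> strictly between \<open>\<beta>\<close> and \<open>f l\<close>
  would eventually lie below the values \<open>f (s n)\<close> and above their bounds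
  \<open>b n\<close>.\<close>

lemma lsc_on_limit_le:
  assumes "lsc_on C f" "l \<in> C" "\<And>n. s n \<in> C" "s \<longlonglongrightarrow> l"
    and "\<And>n. f (s n) \<le> b n" "b \<longlonglongrightarrow> \<beta>"
  shows "f l \<le> \<beta>"
proof (rule ccontr)
  assume "\<not> f l \<le> \<beta>"
  then obtain c where c: "\<beta> < c" "c < f l" using dense not_le by metis
  have "\<forall>\<^sub>F y in at l within C. ereal c < ereal (f y)"
    using assms(1,2) c(2) unfolding lsc_on_def le_Liminf_iff by (metis ereal_less_eq(3) not_le)
  \<comment> \<open>The punctured filter says nothing at \<open>l\<close> itself; there
    \<open>c < f l\<close> fills the gap.\<close>
  then have "\<forall>\<^sub>F y in nhds l. y \<in> C \<longrightarrow> c < f y"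
    unfolding eventually_at_filter by (rule eventually_mono) (use c in auto)
  then have "\<forall>\<^sub>F n in sequentially. s n \<in> C \<longrightarrow> c < f (s n)"
    using assms(4) by (rule eventually_compose_filterlim)
  moreover have "\<forall>\<^sub>F n in sequentially. b n < c"
    using order_tendstoD(2)[OF assms(6) c(1)] .
  ultimately have "\<forall>\<^sub>F n in sequentially. False"
    by eventually_elim (use assms(3,5) in \<open>meson less_le_not_le order_trans not_le\<close>)
  then show False by simp
qed

lemma closed_sublevel_lsc_on:
  fixes C :: "'a::first_countable_topology set"
  assumes "closed C" "lsc_on C f"
  shows "closed {x \<in> C. f x \<le> c}"
  unfolding closed_sequential_limits
proof (intro allI impI)
  fix s l assume s: "(\<forall>n. s n \<in> {x \<in> C. f x \<le> c}) \<and> s \<longlonglongrightarrow> l"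
  then have "l \<in> C" using closed_sequentially[OF assms(1)] by blast
  then show "l \<in> {x \<in> C. f x \<le> c}"
    using lsc_on_limit_le[OF assms(2), of l s "\<lambda>_. c" c] s by auto
qed

lemma convex_sublevel_convex_on:
  fixes f :: "'a::real_vector \<Rightarrow> real"
  assumes "convex_on C f"
  shows "convex {x \<in> C. f x \<le> c}"
  unfolding convex_alt
proof (intro ballI allI impI)
  fix x y and u :: real
  assume x: "x \<in> {x \<in> C. f x \<le> c}" and y: "y \<in> {x \<in> C. f x \<le> c}" and u: "0 \<le> u \<and> u \<le> 1"
  have "f ((1 - u) *\<^sub>R x + u *\<^sub>R y) \<le> (1 - u) * f x + u * f y"
    using convex_onD[OF assms, of u x y] x y u by simp
  also have "\<dots> \<le> (1 - u) * c + u * c"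
    using x y u by (intro add_mono mult_left_mono) auto
  finally show "(1 - u) *\<^sub>R x + u *\<^sub>R y \<in> {x \<in> C. f x \<le> c}"
    using convexD_alt[OF convex_on_imp_convex[OF assms], of x y u] x y u
    by (auto simp: algebra_simps)
qed

text \<open>Minty's lemma: moving the unknown into the second, convex and lower semicontinuous argument
  makes the solution set closed and convex.\<close>

lemma EP_eq_dual:
  assumes "convex C" "equilibrium_bifunction C \<Theta>"
  shows "EP C \<Theta> = {x \<in> C. \<forall>y\<in>C. \<Theta> y x \<le> 0}"
proof (intro equalityI subsetI)
  fix x assume "x \<in> EP C \<Theta>"
  then have x: "x \<in> C" "\<And>y. y \<in> C \<Longrightarrow> \<Theta> x y \<ge> 0" by (auto simp: EP_def)
  have "\<Theta> y x \<le> 0" if "y \<in> C" for y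
    using equilibrium_bifunctionD(2)[OF assms(2) x(1) that] x(2)[OF that] by linarith
  then show "x \<in> {x \<in> C. \<forall>y\<in>C. \<Theta> y x \<le> 0}" using x by simp
next
  fix x assume "x \<in> {x \<in> C. \<forall>y\<in>C. \<Theta> y x \<le> 0}"
  then have x: "x \<in> C" "\<And>y. y \<in> C \<Longrightarrow> \<Theta> y x \<le> 0" by auto
  have "\<Theta> x y \<ge> 0" if "y \<in> C" for y
  proof -
    \<comment> \<open>Convexity bounds \<open>\<Theta> w w = 0\<close> by
      \<open>(1 - t) * \<Theta> w x + t * \<Theta> w y\<close>; the first term is nonpositive and
      \<open>t > 0\<close> divides out.\<close>
    have pos: "\<Theta> (t *\<^sub>R y + (1 - t) *\<^sub>R x) y \<ge> 0" if t: "0 < t" "t < 1" for t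
    proof -
      define w where "w = t *\<^sub>R y + (1 - t) *\<^sub>R x"
      have w: "w \<in> C"
        using convexD_alt[OF assms(1) x(1) \<open>y \<in> C\<close>, of t] t by (simp add: w_def add.commute)
      have "0 = \<Theta> w ((1 - t) *\<^sub>R x + t *\<^sub>R y)"
        using equilibrium_bifunctionD(1)[OF assms(2) w] by (simp add: w_def add.commute)
      also have "\<dots> \<le> (1 - t) * \<Theta> w x + t * \<Theta> w y"
        using convex_onD[OF equilibrium_bifunctionD(4)[OF assms(2) w], of t x y] t x(1) \<open>y \<in> C\<close>
        by simp
      also have "\<dots> \<le> t * \<Theta> w y"
        using x(2)[OF w] t by (simp add: mult_nonneg_nonpos)
      finally show ?thesis using t by (simp add: zero_le_mult_iff w_def)
    qed
    \<comment> \<open>The limsup condition carries the bound from small \<open>t > 0\<close> to the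
      endpoint \<open>x\<close>.\<close>
    have "\<forall>\<^sub>F t in at_right (0::real). 0 < t \<and> t < 1"
      by (auto simp: eventually_at_right_field intro!: exI[of _ 1])
    then have "\<forall>\<^sub>F t in at_right (0::real). 0 \<le> ereal (\<Theta> (t *\<^sub>R y + (1 - t) *\<^sub>R x) y)"
      by eventually_elim (use pos in auto)
    then have "0 \<le> Limsup (at_right 0) (\<lambda>t. ereal (\<Theta> (t *\<^sub>R y + (1 - t) *\<^sub>R x) y))"
      by (intro le_Limsup) auto
    also have "\<dots> \<le> ereal (\<Theta> x y)"
      by (rule equilibrium_bifunctionD(3)[OF assms(2) x(1) that that])
    finally show ?thesis by simp
  qed
  then show "x \<in> EP C \<Theta>" using x by (simp add: EP_def)
qed

lemma closed_convex_EP: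
  assumes "closed C" "convex C" "equilibrium_bifunction C \<Theta>"
  shows "closed (EP C \<Theta>)" "convex (EP C \<Theta>)"
proof -
  \<comment> \<open>The outer \<open>C\<close> matters for empty \<open>C\<close>, where the indexed
    intersection is the whole space.\<close>
  have *: "EP C \<Theta> = C \<inter> (\<Inter>y\<in>C. {x \<in> C. \<Theta> y x \<le> 0})"
    by (auto simp: EP_eq_dual[OF assms(2,3)])
  show "closed (EP C \<Theta>)" "convex (EP C \<Theta>)" unfolding *
    using assms equilibrium_bifunctionD(4,5)[OF assms(3)]
    by (auto intro!: closed_Int convex_Int closed_INT convex_INT
        closed_sublevel_lsc_on convex_sublevel_convex_on)
qed

section \<open>Resolvents of equilibrium bifunctions\<close>

text \<open>Test each inequality with the other point and add: monotonicity removes the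
  \<open>\<Theta>\<close> terms and leaves
  \<open>- (1 / r) * (norm (z - w))\<^sup>2 \<ge> 0\<close>.\<close>

lemma EP_resolvent_unique:
  assumes "equilibrium_bifunction C \<Theta>" "r > 0"
    and z: "z \<in> EP_resolvent_set C \<Theta> r v" and w: "w \<in> EP_resolvent_set C \<Theta> r v"
  shows "z = w"
proof -
  have C: "z \<in> C" "w \<in> C" using z w by (auto simp: EP_resolvent_set_def)
  have "\<Theta> z w + (1 / r) * inner (w - z) (z - v) \<ge> 0" "\<Theta> w z + (1 / r) * inner (z - w) (w - v) \<ge> 0"
    using z w C by (auto simp: EP_resolvent_set_def)
  then have "0 \<le> (1 / r) * inner (w - z) (z - v) + (1 / r) * inner (z - w) (w - v)"
    using equilibrium_bifunctionD(2)[OF assms(1) C] by linarith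
  also have "\<dots> = - (1 / r) * (norm (z - w))\<^sup>2"
    unfolding power2_norm_eq_inner by (simp add: inner_diff inner_commute algebra_simps)
  finally have "(norm (z - w))\<^sup>2 \<le> 0"
    using \<open>r > 0\<close> by (simp add: divide_le_0_iff)
  then show ?thesis by simp
qed

lemma EP_resolvent_ex1:
  assumes "equilibrium_bifunction C \<Theta>" "r > 0" "EP_resolvent_set C \<Theta> r v \<noteq> {}"
  shows "\<exists>!z. z \<in> EP_resolvent_set C \<Theta> r v"
  using assms EP_resolvent_unique[OF assms(1,2)] by blast

text \<open>Testing the resolvent inequality with \<open>p\<close>, where
  \<open>\<Theta> z p \<le> - \<Theta> p z \<le> 0\<close>, gives the same obtuse angle as for a
  metric projection.\<close>

lemma EP_resolvent_pythagoras:
  assumes "equilibrium_bifunction C \<Theta>" "r > 0"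
    and z: "z \<in> EP_resolvent_set C \<Theta> r v" and p: "p \<in> EP C \<Theta>"
  shows "(norm (p - z))\<^sup>2 + (norm (z - v))\<^sup>2 \<le> (norm (p - v))\<^sup>2"
proof -
  have C: "z \<in> C" "p \<in> C" using z p by (auto simp: EP_resolvent_set_def EP_def)
  have "\<Theta> z p + (1 / r) * inner (p - z) (z - v) \<ge> 0" "\<Theta> p z \<ge> 0"
    using z p C by (auto simp: EP_resolvent_set_def EP_def)
  then have "0 \<le> (1 / r) * inner (p - z) (z - v)"
    using equilibrium_bifunctionD(2)[OF assms(1) C] by linarith
  then have "0 \<le> inner (p - z) (z - v)"
    using \<open>r > 0\<close> by (simp add: zero_le_divide_iff)
  then show ?thesis
    unfolding power2_norm_eq_inner by (simp add: inner_diff inner_commute algebra_simps)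
qed

text \<open>Monotonicity moves \<open>z n\<close> into the second argument, where lower
  semicontinuity allows passing to the limit; Minty's lemma returns to \<open>EP\<close>. The lower
  bound \<open>r0\<close> keeps \<open>1 / r n\<close> bounded, so the perturbation
  vanishes.\<close>

lemma EP_resolvent_limit:
  fixes C :: "'a::real_inner set"
  assumes "closed C" "convex C" "equilibrium_bifunction C \<Theta>" "r0 > 0" "\<And>n. r n \<ge> r0"
    and z: "\<And>n. z n \<in> EP_resolvent_set C \<Theta> (r n) (v n)"
    and lim: "z \<longlonglongrightarrow> l" "v \<longlonglongrightarrow> l"
  shows "l \<in> EP C \<Theta>"
proof -
  have zC: "z n \<in> C" for n using z[of n] by (simp add: EP_resolvent_set_def)
  have "l \<in> C" using closed_sequentially[OF assms(1)] zC lim(1) by blast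
  moreover have "\<Theta> y l \<le> 0" if y: "y \<in> C" for y
  proof (rule lsc_on_limit_le[where s = z])
    show "lsc_on C (\<Theta> y)" by (rule equilibrium_bifunctionD(5)[OF assms(3) y])
    show "\<Theta> y (z n) \<le> (1 / r0) * (norm (y - z n) * norm (z n - v n))" for n
    proof -
      have "\<Theta> y (z n) \<le> - \<Theta> (z n) y"
        using equilibrium_bifunctionD(2)[OF assms(3) y zC] by (smt (verit))
      also have "\<dots> \<le> (1 / r n) * inner (y - z n) (z n - v n)"
        using z[of n] y by (force simp: EP_resolvent_set_def)
      also have "\<dots> \<le> (1 / r n) * (norm (y - z n) * norm (z n - v n))"
        using assms(4) assms(5)[of n] by (intro mult_left_mono norm_cauchy_schwarz) auto
      also have "\<dots> \<le> (1 / r0) * (norm (y - z n) * norm (z n - v n))"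
        using assms(4) assms(5)[of n] by (intro mult_right_mono frac_le) auto
      finally show ?thesis .
    qed
    have "(\<lambda>n. (1 / r0) * (norm (y - z n) * norm (z n - v n)))
        \<longlonglongrightarrow> (1 / r0) * (norm (y - l) * norm (l - l))"
      by (intro tendsto_intros lim)
    then show "(\<lambda>n. (1 / r0) * (norm (y - z n) * norm (z n - v n))) \<longlonglongrightarrow> 0" by simp
  qed (use \<open>l \<in> C\<close> zC lim in auto)
  ultimately show ?thesis by (simp add: EP_eq_dual[OF assms(2,3)])
qed

section \<open>Variational inequalities as equilibrium problems\<close>

text \<open>With this bifunction the operators \<open>A k\<close> and their resolvents become
  instances of the equilibrium theory, so one argument serves both families.\<close>

definition VI_bifunction :: "('a::real_inner \<Rightarrow> 'a) \<Rightarrow> 'a \<Rightarrow> 'a \<Rightarrow> real"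
  where "VI_bifunction A v w = inner (w - v) (A v)"

lemma VI_eq_EP: "VI C A = EP C (VI_bifunction A)"
  by (simp add: VI_def EP_def VI_bifunction_def)

lemma VI_resolvent_set_eq: "VI_resolvent_set C A r v = EP_resolvent_set C (VI_bifunction A) r v"
  by (simp add: VI_resolvent_set_def EP_resolvent_set_def VI_bifunction_def)

lemma VI_resolvent_eq: "VI_resolvent C A r v = EP_resolvent C (VI_bifunction A) r v"
  by (simp add: VI_resolvent_def EP_resolvent_def VI_resolvent_set_eq)

text \<open>Continuity of \<open>A\<close> makes the limsup along a segment a true limit; in the
  second argument the bifunction is affine and continuous.\<close>

lemma equilibrium_bifunction_VI:
  fixes C :: "'a::real_inner set"
  assumes "convex C" "continuous_on C A" "monotone_operator C A"
  shows "equilibrium_bifunction C (VI_bifunction A)"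
  unfolding equilibrium_bifunction_def
proof (intro conjI ballI)
  show "VI_bifunction A x x = 0" for x by (simp add: VI_bifunction_def)
  show "VI_bifunction A x y + VI_bifunction A y x \<le> 0" if "x \<in> C" "y \<in> C" for x y
  proof -
    have "inner (x - y) (A x - A y) \<ge> 0"
      using assms(3) that by (simp add: monotone_operator_def)
    then show ?thesis by (simp add: VI_bifunction_def inner_diff algebra_simps)
  qed
  show "Limsup (at_right 0) (\<lambda>t. ereal (VI_bifunction A (t *\<^sub>R z + (1 - t) *\<^sub>R x) y))
      \<le> ereal (VI_bifunction A x y)" if C: "x \<in> C" "y \<in> C" "z \<in> C" for x y z
  proof -
    let ?w = "\<lambda>t::real. t *\<^sub>R z + (1 - t) *\<^sub>R x"
    have w: "(?w \<longlongrightarrow> x) (at_right 0)"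
      by (rule tendsto_eq_intros refl | simp)+
    have wC: "\<forall>\<^sub>F t in at_right 0. ?w t \<in> C"
      unfolding eventually_at_right_field
      using convexD_alt[OF assms(1) C(1,3)] by (intro exI[of _ 1]) (auto simp: add.commute)
    have "((\<lambda>t. A (?w t)) \<longlongrightarrow> A x) (at_right 0)"
      by (rule continuous_on_tendsto_compose[OF assms(2) w C(1) wC])
    then have "((\<lambda>t. ereal (VI_bifunction A (?w t) y)) \<longlongrightarrow> ereal (VI_bifunction A x y)) (at_right 0)"
      unfolding VI_bifunction_def by (intro tendsto_intros w)
    then show ?thesis by (intro eq_refl lim_imp_Limsup) simp_all
  qed
  show "convex_on C (VI_bifunction A x)" for x
    using assms(1)
    by (auto simp: convex_on_def VI_bifunction_def inner_simps algebra_simps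
        simp flip: distrib_right)
  show "lsc_on C (VI_bifunction A x)" for x
    unfolding lsc_on_def
  proof
    fix y
    have "((\<lambda>w. ereal (VI_bifunction A x w)) \<longlongrightarrow> ereal (VI_bifunction A x y)) (at y within C)"
      unfolding VI_bifunction_def by (intro tendsto_intros)
    then show "ereal (VI_bifunction A x y) \<le> Liminf (at y within C) (\<lambda>w. ereal (VI_bifunction A x w))"
      \<comment> \<open>If \<open>y\<close> is not a limit point of \<open>C\<close>, the filter is
        trivial and the liminf infinite.\<close>
      by (cases "at y within C = bot") (simp, intro eq_refl lim_imp_Liminf[symmetric])
  qed
qed

subsection \<open>Fixed points\<close>

text \<open>Testing with \<open>x = p\<close> forces \<open>norm (p - T p) \<le> 0\<close>; the
  other inclusion is nonexpansiveness. The right-hand side is visibly closed and convex.\<close>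

lemma fixed_points_eq_bisectors:
  assumes "bregman_nonexpansive C T"
  shows "fixed_points C T = C \<inter> (\<Inter>x\<in>C. {p \<in> C. norm (p - T x) \<le> norm (p - x)})"
  using assms unfolding bregman_nonexpansive_def fixed_points_def by force

lemma closed_convex_fixed_points:
  fixes C :: "'a::real_inner set"
  assumes "closed C" "convex C" "bregman_nonexpansive C T"
  shows "closed (fixed_points C T)" "convex (fixed_points C T)"
  unfolding fixed_points_eq_bisectors[OF assms(3)]
  using assms(1,2)
  by (auto intro!: closed_Int convex_Int closed_INT convex_INT closed_convex_bisector)

subsection \<open>Convergence of the hybrid projection algorithm\<close>

text \<open>The gap between the two sides is the sum of the squared pairwise distances, weighted by
  products of the coefficients.\<close>

lemma power2_norm_convex_combination3:
  fixes a b c :: "'a::real_inner"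
  assumes "\<alpha>1 \<ge> 0" "\<alpha>2 \<ge> 0" "\<alpha>3 \<ge> 0" "\<alpha>1 + \<alpha>2 + \<alpha>3 = 1"
  shows "(norm (\<alpha>1 *\<^sub>R a + \<alpha>2 *\<^sub>R b + \<alpha>3 *\<^sub>R c))\<^sup>2
    \<le> \<alpha>1 * (norm a)\<^sup>2 + \<alpha>2 * (norm b)\<^sup>2 + \<alpha>3 * (norm c)\<^sup>2"
proof -
  have \<alpha>1: "\<alpha>1 = 1 - \<alpha>2 - \<alpha>3" using assms(4) by simp
  have "\<alpha>1 * (norm a)\<^sup>2 + \<alpha>2 * (norm b)\<^sup>2 + \<alpha>3 * (norm c)\<^sup>2
      - (norm (\<alpha>1 *\<^sub>R a + \<alpha>2 *\<^sub>R b + \<alpha>3 *\<^sub>R c))\<^sup>2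
    = \<alpha>1 * \<alpha>2 * (norm (a - b))\<^sup>2 + \<alpha>1 * \<alpha>3 * (norm (a - c))\<^sup>2 + \<alpha>2 * \<alpha>3 * (norm (b - c))\<^sup>2"
    unfolding power2_norm_eq_inner \<alpha>1 by (simp add: inner_simps inner_commute algebra_simps)
  also have "\<dots> \<ge> 0" using assms by simp
  finally show ?thesis by simp
qed

lemma takes_all_values_subseq:
  assumes "takes_all_values_infinitely_often \<tau>" "k \<ge> 1"
  obtains \<sigma> :: "nat \<Rightarrow> nat" where "strict_mono \<sigma>" "\<And>n. \<sigma> n \<ge> 1" "\<And>n. \<tau> (\<sigma> n) = k"
proof -
  have "infinite {n. n \<ge> 1 \<and> \<tau> n = k}"
    using assms by (simp add: takes_all_values_infinitely_often_def)
  then show ?thesis using infinite_enumerate that by force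
qed

lemma takes_all_values_ge_1:
  "takes_all_values_infinitely_often \<tau> \<Longrightarrow> n \<ge> 1 \<Longrightarrow> \<tau> n \<ge> 1"
  by (simp add: takes_all_values_infinitely_often_def)

text \<open>An arbitrary run of the algorithm. \<open>\<Phi>\<close> stands for the bifunctions of
  the variational inequalities, so both resolvent steps have the same form.\<close>

locale hybrid_projection =
  fixes C :: "'a::{real_inner, complete_space} set"
    and \<Theta> \<Phi> :: "nat \<Rightarrow> 'a \<Rightarrow> 'a \<Rightarrow> real" and T :: "nat \<Rightarrow> 'a \<Rightarrow> 'a"
    and \<tau>\<Theta> \<tau>\<Phi> \<tau>T :: "nat \<Rightarrow> nat"
    and \<alpha>1 \<alpha>2 \<alpha>3 r0 :: real and r :: "nat \<Rightarrow> real"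
    and x :: 'a and X Z U Y :: "nat \<Rightarrow> 'a" and D :: "nat \<Rightarrow> 'a set" and S :: "'a set"
  assumes C: "closed C" "convex C" "x \<in> C"
    and \<Theta>: "\<And>l. l \<ge> 1 \<Longrightarrow> equilibrium_bifunction C (\<Theta> l)"
    and \<Phi>: "\<And>l. l \<ge> 1 \<Longrightarrow> equilibrium_bifunction C (\<Phi> l)"
    and J_closed: "\<And>j. j \<ge> 1 \<Longrightarrow> J_closed C (T j)"
    and nonexpansive: "\<And>j. j \<ge> 1 \<Longrightarrow> bregman_nonexpansive C (T j)"
    and \<Theta>_resolvent: "\<And>l v s. l \<ge> 1 \<Longrightarrow> v \<in> C \<Longrightarrow> s > 0 \<Longrightarrow> EP_resolvent_set C (\<Theta> l) s v \<noteq> {}"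
    and \<Phi>_resolvent: "\<And>l v s. l \<ge> 1 \<Longrightarrow> v \<in> C \<Longrightarrow> s > 0 \<Longrightarrow> EP_resolvent_set C (\<Phi> l) s v \<noteq> {}"
    and S_eq: "S = (\<Inter>j\<in>{1..}. fixed_points C (T j)) \<inter> (\<Inter>l\<in>{1..}. EP C (\<Theta> l)) \<inter>
      (\<Inter>l\<in>{1..}. EP C (\<Phi> l))"
    and S_nonempty: "S \<noteq> {}"
    and \<alpha>: "\<alpha>1 > 0" "\<alpha>2 > 0" "\<alpha>3 > 0" "\<alpha>1 + \<alpha>2 + \<alpha>3 = 1"
    and r0: "r0 > 0" and r_ge: "\<And>n. n \<ge> 1 \<Longrightarrow> r n \<ge> r0"
    and \<tau>T: "takes_all_values_infinitely_often \<tau>T"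
    and \<tau>\<Phi>: "takes_all_values_infinitely_often \<tau>\<Phi>"
    and \<tau>\<Theta>: "takes_all_values_infinitely_often \<tau>\<Theta>"
    and X_1: "X 1 = x" and D_1: "D 1 = C"
    and Z_eq: "\<And>n. n \<ge> 1 \<Longrightarrow> Z n = EP_resolvent C (\<Theta> (\<tau>\<Theta> n)) (r n) (X n)"
    and U_eq: "\<And>n. n \<ge> 1 \<Longrightarrow> U n = EP_resolvent C (\<Phi> (\<tau>\<Phi> n)) (r n) (X n)"
    and Y_eq: "\<And>n. n \<ge> 1 \<Longrightarrow> Y n = \<alpha>1 *\<^sub>R X n + \<alpha>2 *\<^sub>R Z n + \<alpha>3 *\<^sub>R T (\<tau>T n) (U n)"
    and D_Suc: "\<And>n. n \<ge> 1 \<Longrightarrow> D (Suc n) = {z \<in> D n. norm (z - Y n) \<le> norm (z - X n)}"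
    and X_Suc: "\<And>n. n \<ge> 1 \<Longrightarrow> X (Suc n) = metric_proj (D (Suc n)) x"
begin

lemma S_subset: "S \<subseteq> C"
  unfolding S_eq by (auto simp: EP_def)

lemma closed_convex_S: "closed S" "convex S"
  unfolding S_eq
  using closed_convex_EP[OF C(1,2) \<Theta>] closed_convex_EP[OF C(1,2) \<Phi>]
    closed_convex_fixed_points[OF C(1,2) nonexpansive]
  by (auto intro!: closed_Int convex_Int closed_INT convex_INT)

lemma r_pos: "n \<ge> 1 \<Longrightarrow> r n > 0"
  using r0 r_ge by (meson less_le_trans)

lemma resolvents_ex1:
  assumes "n \<ge> 1" "X n \<in> C"
  shows "\<exists>!z. z \<in> EP_resolvent_set C (\<Theta> (\<tau>\<Theta> n)) (r n) (X n)"
    and "\<exists>!u. u \<in> EP_resolvent_set C (\<Phi> (\<tau>\<Phi> n)) (r n) (X n)"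
  using assms takes_all_values_ge_1[OF \<tau>\<Theta>] takes_all_values_ge_1[OF \<tau>\<Phi>] r_pos
  by (intro EP_resolvent_ex1 \<Theta> \<Phi> \<Theta>_resolvent \<Phi>_resolvent; blast)+

lemma resolvents_mem:
  assumes "n \<ge> 1" "X n \<in> C"
  shows "Z n \<in> EP_resolvent_set C (\<Theta> (\<tau>\<Theta> n)) (r n) (X n)"
    and "U n \<in> EP_resolvent_set C (\<Phi> (\<tau>\<Phi> n)) (r n) (X n)"
  using theI'[OF resolvents_ex1(1)[OF assms]] theI'[OF resolvents_ex1(2)[OF assms]] assms
  by (simp_all add: Z_eq U_eq EP_resolvent_def)

text \<open>\<open>p - Y n\<close> is the convex combination of the differences to
  \<open>X n\<close>, \<open>Z n\<close> and \<open>T (\<tau>T n) (U n)\<close>. The resolvents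
  contribute the two gains, and \<open>T\<close> does not increase the distance to
  \<open>p\<close>.\<close>

lemma Y_descent:
  assumes n: "n \<ge> 1" and XC: "X n \<in> C" and p: "p \<in> S"
  shows "(norm (p - Y n))\<^sup>2 + \<alpha>2 * (norm (Z n - X n))\<^sup>2 + \<alpha>3 * (norm (U n - X n))\<^sup>2
    \<le> (norm (p - X n))\<^sup>2"
proof -
  let ?W = "T (\<tau>T n) (U n)"
  have \<tau>: "\<tau>\<Theta> n \<ge> 1" "\<tau>\<Phi> n \<ge> 1" "\<tau>T n \<ge> 1"
    using n takes_all_values_ge_1 \<tau>\<Theta> \<tau>\<Phi> \<tau>T by auto
  have pm: "p \<in> EP C (\<Theta> (\<tau>\<Theta> n))" "p \<in> EP C (\<Phi> (\<tau>\<Phi> n))" "p \<in> fixed_points C (T (\<tau>T n))"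
    using p \<tau> unfolding S_eq by auto
  have z: "(norm (p - Z n))\<^sup>2 + (norm (Z n - X n))\<^sup>2 \<le> (norm (p - X n))\<^sup>2"
    by (rule EP_resolvent_pythagoras[OF \<Theta>[OF \<tau>(1)] r_pos[OF n] resolvents_mem(1)[OF n XC] pm(1)])
  have u: "(norm (p - U n))\<^sup>2 + (norm (U n - X n))\<^sup>2 \<le> (norm (p - X n))\<^sup>2"
    by (rule EP_resolvent_pythagoras[OF \<Phi>[OF \<tau>(2)] r_pos[OF n] resolvents_mem(2)[OF n XC] pm(2)])
  have "U n \<in> C" using resolvents_mem(2)[OF n XC] by (simp add: EP_resolvent_set_def)
  then have "norm (p - ?W) \<le> norm (p - U n)"
    using nonexpansive[OF \<tau>(3)] pm(3) by (simp add: bregman_nonexpansive_def)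
  then have w: "(norm (p - ?W))\<^sup>2 \<le> (norm (p - U n))\<^sup>2" by (simp add: power_mono)
  have "p = \<alpha>1 *\<^sub>R p + \<alpha>2 *\<^sub>R p + \<alpha>3 *\<^sub>R p" using \<alpha>(4) by (metis scaleR_left_distrib scaleR_one)
  then have "p - Y n = \<alpha>1 *\<^sub>R (p - X n) + \<alpha>2 *\<^sub>R (p - Z n) + \<alpha>3 *\<^sub>R (p - ?W)"
    using Y_eq[OF n] by (simp add: scaleR_diff_right)
  then have "(norm (p - Y n))\<^sup>2
      \<le> \<alpha>1 * (norm (p - X n))\<^sup>2 + \<alpha>2 * (norm (p - Z n))\<^sup>2 + \<alpha>3 * (norm (p - ?W))\<^sup>2"
    using power2_norm_convex_combination3[of \<alpha>1 \<alpha>2 \<alpha>3] \<alpha> by simp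
  also have "\<dots> \<le> \<alpha>1 * (norm (p - X n))\<^sup>2 + \<alpha>2 * ((norm (p - X n))\<^sup>2 - (norm (Z n - X n))\<^sup>2)
      + \<alpha>3 * ((norm (p - X n))\<^sup>2 - (norm (U n - X n))\<^sup>2)"
    using z u w \<alpha> by (intro add_mono mult_left_mono; linarith)
  also have "\<dots> = (\<alpha>1 + \<alpha>2 + \<alpha>3) * (norm (p - X n))\<^sup>2 - \<alpha>2 * (norm (Z n - X n))\<^sup>2
      - \<alpha>3 * (norm (U n - X n))\<^sup>2"
    by (simp add: algebra_simps)
  finally show ?thesis using \<alpha>(4) by simp
qed

text \<open>One joint induction, as the claims depend on each other: descent needs
  \<open>X n \<in> C\<close>, descent keeps \<open>S\<close> inside the next set, and this makes
  that set nonempty, so that the next projection exists.\<close>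

lemma D_invariants:
  assumes "n \<ge> 1"
  shows "closed (D n) \<and> convex (D n) \<and> S \<subseteq> D n \<and> D n \<subseteq> C \<and> X n = metric_proj (D n) x \<and> X n \<in> C"
  using assms
proof (induction n rule: nat_induct_at_least)
  case base
  \<comment> \<open>The starting point fits the pattern because a point of \<open>C\<close> is its
    own projection.\<close>
  have "metric_proj C x = x" using C by (intro metric_proj_eqI) auto
  then show ?case using C S_subset by (simp only: X_1 D_1) auto
next
  case (Suc n)
  have cc: "closed (D (Suc n))" "convex (D (Suc n))"
    unfolding D_Suc[OF Suc(1)] using closed_convex_bisector Suc(2) by blast+
  have "norm (p - Y n) \<le> norm (p - X n)" if "p \<in> S" for p
  proof -
    have "\<alpha>2 * (norm (Z n - X n))\<^sup>2 \<ge> 0" "\<alpha>3 * (norm (U n - X n))\<^sup>2 \<ge> 0" using \<alpha> by auto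
    then have "(norm (p - Y n))\<^sup>2 \<le> (norm (p - X n))\<^sup>2"
      using Y_descent[OF Suc(1) _ that] Suc(2) by linarith
    then show ?thesis by (rule power2_le_imp_le) simp
  qed
  then have S: "S \<subseteq> D (Suc n)" using Suc by (auto simp: D_Suc)
  have "D (Suc n) \<subseteq> C" using Suc by (auto simp: D_Suc)
  moreover have "D (Suc n) \<noteq> {}" using S S_nonempty by auto
  then have "X (Suc n) \<in> D (Suc n)"
    using metric_proj_arg_min(1)[OF cc] X_Suc[OF Suc(1)] by simp
  ultimately show ?case using cc S X_Suc[OF Suc(1)] by blast
qed

lemma closed_convex_D: "n \<ge> 1 \<Longrightarrow> closed (D n)" "n \<ge> 1 \<Longrightarrow> convex (D n)"
  and S_subset_D: "n \<ge> 1 \<Longrightarrow> S \<subseteq> D n"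
  and X_eq_proj: "n \<ge> 1 \<Longrightarrow> X n = metric_proj (D n) x"
  and X_in_C: "n \<ge> 1 \<Longrightarrow> X n \<in> C"
  using D_invariants by blast+

lemma D_nonempty: "n \<ge> 1 \<Longrightarrow> D n \<noteq> {}"
  using S_subset_D S_nonempty by blast

lemma X_in_D: "n \<ge> 1 \<Longrightarrow> X n \<in> D n"
  using metric_proj_arg_min(1)[OF closed_convex_D D_nonempty, of n] X_eq_proj by simp

section \<open>Monotone distances and the Cauchy property\<close>

lemma D_antimono:
  assumes "1 \<le> n" "n \<le> m"
  shows "D m \<subseteq> D n"
  using assms(2,1) by (induction m rule: dec_induct) (auto simp: D_Suc)

lemma X_pythagoras:
  assumes "n \<ge> 1" "z \<in> D n"
  shows "(norm (X n - x))\<^sup>2 + (norm (z - X n))\<^sup>2 \<le> (norm (z - x))\<^sup>2"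
  using metric_proj_pythagoras[OF closed_convex_D[OF assms(1)] assms(2)] X_eq_proj[OF assms(1)]
  by simp

lemma X_pythagoras_seq:
  assumes "1 \<le> n" "n \<le> m"
  shows "(norm (X n - x))\<^sup>2 + (norm (X m - X n))\<^sup>2 \<le> (norm (X m - x))\<^sup>2"
  using X_pythagoras[OF assms(1)] X_in_D[of m] D_antimono[OF assms] assms by auto

text \<open>The squared distances to \<open>x\<close> increase and are bounded by that of any point of \<open>S\<close>;
  the Pythagorean inequality turns their convergence into the Cauchy property.\<close>

lemma X_convergent: obtains l where "X \<longlonglongrightarrow> l"
proof -
  \<comment> \<open>The shift skips index 0, where \<open>X\<close> is unconstrained.\<close>
  define a where "a n = (norm (X (Suc n) - x))\<^sup>2" for n
  obtain p where p: "p \<in> S" using S_nonempty by auto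
  have step: "a n + (norm (X (Suc m) - X (Suc n)))\<^sup>2 \<le> a m" if "n \<le> m" for n m
    using X_pythagoras_seq[of "Suc n" "Suc m"] that by (simp add: a_def)
  have "incseq a" using step unfolding incseq_def by (smt (verit) zero_le_power2)
  moreover have "a n \<le> (norm (p - x))\<^sup>2" for n
  proof -
    have "p \<in> D (Suc n)" using S_subset_D[of "Suc n"] p by auto
    then show ?thesis using X_pythagoras[of "Suc n" p] unfolding a_def by (smt (verit) zero_le_power2 le_add1 Suc_eq_plus1_left)
  qed
  ultimately have "Cauchy a"
    by (metis incseq_convergent LIMSEQ_imp_Cauchy)
  have "Cauchy (\<lambda>n. X (Suc n))"
  proof (rule CauchyI')
    fix e :: real assume "e > 0"
    then obtain M where M: "\<And>m n. m \<ge> M \<Longrightarrow> n \<ge> M \<Longrightarrow> norm (a m - a n) < e\<^sup>2"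
      using CauchyD[OF \<open>Cauchy a\<close>, of "e\<^sup>2"] by auto
    have "dist (X (Suc m)) (X (Suc n)) < e" if "m \<ge> M" "n > m" for m n
    proof -
      \<comment> \<open>The squared step is at most \<open>a n - a m\<close>.\<close>
      have "(norm (X (Suc n) - X (Suc m)))\<^sup>2 < e\<^sup>2"
        using step[of m n] M[of n m] that by auto
      then show ?thesis using \<open>e > 0\<close> by (simp add: dist_norm norm_minus_commute power2_less_imp_less)
    qed
    then show "\<exists>M. \<forall>m\<ge>M. \<forall>n>m. dist (X (Suc m)) (X (Suc n)) < e" by blast
  qed
  then show ?thesis using that unfolding Cauchy_convergent_iff convergent_def filterlim_sequentially_Suc by blast
qed

section \<open>Identification of the limit\<close>

lemma X_step_le:
  assumes "n \<ge> 1"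
  shows "norm (X (Suc n) - Y n) \<le> norm (X (Suc n) - X n)"
  using X_in_D[of "Suc n"] D_Suc[OF assms] by simp

text \<open>\<open>X_step_le\<close> ties \<open>Y\<close> to \<open>X\<close>; the descent
  inequality then squeezes \<open>Z\<close> and \<open>U\<close>; the images under \<open>T\<close>
  are recovered by solving the formula for \<open>Y n\<close>.\<close>

lemma limits:
  assumes X: "X \<longlonglongrightarrow> l"
  shows "Z \<longlonglongrightarrow> l" "U \<longlonglongrightarrow> l" "(\<lambda>n. T (\<tau>T n) (U n)) \<longlonglongrightarrow> l"
proof -
  have ev: "\<forall>\<^sub>F n in sequentially. n \<ge> (1::nat)" by (rule eventually_ge_at_top)
  have XS: "(\<lambda>n. X (Suc n)) \<longlonglongrightarrow> l" by (rule LIMSEQ_Suc[OF X])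
  have "(\<lambda>n. norm (X (Suc n) - X n)) \<longlonglongrightarrow> 0"
    using tendsto_norm[OF tendsto_diff[OF XS X]] by simp
  then have "(\<lambda>n. X (Suc n) - Y n) \<longlonglongrightarrow> 0"
    by (rule Lim_null_comparison[rotated]) (rule eventually_mono[OF ev X_step_le])
  from tendsto_diff[OF XS this] have Y: "Y \<longlonglongrightarrow> l" by simp
  obtain p where p: "p \<in> S" using S_nonempty by auto
  \<comment> \<open>The drop in the descent inequality; it vanishes because \<open>X\<close> and
    \<open>Y\<close> share their limit, and it dominates both gains.\<close>
  define b where "b n = (norm (p - X n))\<^sup>2 - (norm (p - Y n))\<^sup>2" for n
  have "b \<longlonglongrightarrow> (norm (p - l))\<^sup>2 - (norm (p - l))\<^sup>2"
    unfolding b_def by (intro tendsto_intros X Y)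
  then have b: "b \<longlonglongrightarrow> 0" by simp
  have vanish: "V \<longlonglongrightarrow> l"
    if "c > 0" and bound: "\<And>n. n \<ge> 1 \<Longrightarrow> c * (norm (V n - X n))\<^sup>2 \<le> b n" for V :: "nat \<Rightarrow> 'a" and c
  proof -
    have "(\<lambda>n. sqrt (b n / c)) \<longlonglongrightarrow> sqrt (0 / c)"
      by (intro tendsto_intros b) (use \<open>c > 0\<close> in auto)
    then have "(\<lambda>n. sqrt (b n / c)) \<longlonglongrightarrow> 0" by simp
    moreover have le: "norm (V n - X n) \<le> sqrt (b n / c)" if "n \<ge> 1" for n
      using bound[OF that] \<open>c > 0\<close>
      by (intro real_le_rsqrt) (simp add: field_simps)
    ultimately have "(\<lambda>n. V n - X n) \<longlonglongrightarrow> 0"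
      by (rule Lim_null_comparison[OF eventually_mono[OF ev], rotated])
    from tendsto_add[OF this X] show ?thesis by simp
  qed
  have desc: "\<alpha>2 * (norm (Z n - X n))\<^sup>2 + \<alpha>3 * (norm (U n - X n))\<^sup>2 \<le> b n" if "n \<ge> 1" for n
    using Y_descent[OF that X_in_C[OF that] p] unfolding b_def by linarith
  have "\<alpha>2 * (norm (Z n - X n))\<^sup>2 \<le> b n" "\<alpha>3 * (norm (U n - X n))\<^sup>2 \<le> b n" if "n \<ge> 1" for n
    using desc[OF that] \<alpha> by (smt (verit) mult_nonneg_nonneg zero_le_power2)+
  then show Z: "Z \<longlonglongrightarrow> l" and "U \<longlonglongrightarrow> l"
    by (auto intro: vanish[OF \<alpha>(2)] vanish[OF \<alpha>(3)])
  \<comment> \<open>Division by \<open>\<alpha>3 > 0\<close> isolates the \<open>T\<close> term;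
    since the weights sum to one, its limit is again \<open>l\<close>.\<close>
  have "(\<lambda>n. (1 / \<alpha>3) *\<^sub>R (Y n - \<alpha>1 *\<^sub>R X n - \<alpha>2 *\<^sub>R Z n))
      \<longlonglongrightarrow> (1 / \<alpha>3) *\<^sub>R (l - \<alpha>1 *\<^sub>R l - \<alpha>2 *\<^sub>R l)"
    by (intro tendsto_intros X Y Z)
  moreover have "\<alpha>3 = 1 - \<alpha>1 - \<alpha>2" using \<alpha>(4) by simp
  then have "l - \<alpha>1 *\<^sub>R l - \<alpha>2 *\<^sub>R l = \<alpha>3 *\<^sub>R l"
    by (simp add: scaleR_diff_left)
  then have "(1 / \<alpha>3) *\<^sub>R (l - \<alpha>1 *\<^sub>R l - \<alpha>2 *\<^sub>R l) = l"
    using \<alpha>(3) by simp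
  moreover have "\<forall>\<^sub>F n in sequentially.
      (1 / \<alpha>3) *\<^sub>R (Y n - \<alpha>1 *\<^sub>R X n - \<alpha>2 *\<^sub>R Z n) = T (\<tau>T n) (U n)"
    using ev by eventually_elim (use Y_eq \<alpha> in simp)
  ultimately show "(\<lambda>n. T (\<tau>T n) (U n)) \<longlonglongrightarrow> l"
    by (simp add: tendsto_cong)
qed

text \<open>Fix an index and pass to a subsequence on which it is selected: there a single
  bifunction or mapping acts, and \<open>EP_resolvent_limit\<close> or \<open>J_closed\<close>
  applies.\<close>

lemma limit_in_S:
  assumes X: "X \<longlonglongrightarrow> l"
  shows "l \<in> S"
proof -
  note lims = limits[OF X]
  have U_C: "U n \<in> C" if "n \<ge> 1" for n
    using resolvents_mem(2)[OF that X_in_C[OF that]] by (simp add: EP_resolvent_set_def)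
  have "l \<in> EP C (\<Theta> k)" if k: "k \<ge> 1" for k
  proof -
    obtain \<sigma> :: "nat \<Rightarrow> nat" where \<sigma>: "strict_mono \<sigma>" "\<And>n. \<sigma> n \<ge> 1" "\<And>n. \<tau>\<Theta> (\<sigma> n) = k"
      using takes_all_values_subseq[OF \<tau>\<Theta> k] by blast
    show ?thesis
    proof (rule EP_resolvent_limit[where z = "Z \<circ> \<sigma>" and v = "X \<circ> \<sigma>" and r = "r \<circ> \<sigma>",
          OF C(1,2) \<Theta>[OF k] r0])
      show "(Z \<circ> \<sigma>) n \<in> EP_resolvent_set C (\<Theta> k) ((r \<circ> \<sigma>) n) ((X \<circ> \<sigma>) n)" for n
        using resolvents_mem(1)[OF \<sigma>(2) X_in_C[OF \<sigma>(2)], of n] \<sigma>(3) by simp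
    qed (use r_ge \<sigma>(2) LIMSEQ_subseq_LIMSEQ[OF _ \<sigma>(1)] lims(1) X in auto)
  qed
  moreover have "l \<in> EP C (\<Phi> k)" if k: "k \<ge> 1" for k
  proof -
    obtain \<sigma> :: "nat \<Rightarrow> nat" where \<sigma>: "strict_mono \<sigma>" "\<And>n. \<sigma> n \<ge> 1" "\<And>n. \<tau>\<Phi> (\<sigma> n) = k"
      using takes_all_values_subseq[OF \<tau>\<Phi> k] by blast
    show ?thesis
    proof (rule EP_resolvent_limit[where z = "U \<circ> \<sigma>" and v = "X \<circ> \<sigma>" and r = "r \<circ> \<sigma>",
          OF C(1,2) \<Phi>[OF k] r0])
      show "(U \<circ> \<sigma>) n \<in> EP_resolvent_set C (\<Phi> k) ((r \<circ> \<sigma>) n) ((X \<circ> \<sigma>) n)" for n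
        using resolvents_mem(2)[OF \<sigma>(2) X_in_C[OF \<sigma>(2)], of n] \<sigma>(3) by simp
    qed (use r_ge \<sigma>(2) LIMSEQ_subseq_LIMSEQ[OF _ \<sigma>(1)] lims(2) X in auto)
  qed
  moreover have "l \<in> fixed_points C (T k)" if k: "k \<ge> 1" for k
  proof -
    obtain \<sigma> :: "nat \<Rightarrow> nat" where \<sigma>: "strict_mono \<sigma>" "\<And>n. \<sigma> n \<ge> 1" "\<And>n. \<tau>T (\<sigma> n) = k"
      using takes_all_values_subseq[OF \<tau>T k] by blast
    have u: "(\<lambda>n. U (\<sigma> n)) \<longlonglongrightarrow> l" "(\<lambda>n. T k (U (\<sigma> n))) \<longlonglongrightarrow> l"
      using LIMSEQ_subseq_LIMSEQ[OF lims(2) \<sigma>(1)] LIMSEQ_subseq_LIMSEQ[OF lims(3) \<sigma>(1)]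
      by (simp_all add: o_def \<sigma>(3))
    have "\<forall>n. U (\<sigma> n) \<in> C" using U_C \<sigma>(2) by blast
    moreover from this have "l \<in> C" using closed_sequentially[OF C(1) _ u(1)] by blast
    ultimately have "l = T k l"
      using J_closed[OF k] u unfolding J_closed_def
      by (elim conjE allE[of _ "\<lambda>n. U (\<sigma> n)"] allE[of _ l]) simp
    then show ?thesis using \<open>l \<in> C\<close> by (simp add: fixed_points_def)
  qed
  ultimately show ?thesis unfolding S_eq by auto
qed

text \<open>Since \<open>S\<close> lies in every \<open>D n\<close>, no point of \<open>S\<close> is
  closer to \<open>x\<close> than \<open>X n\<close>; this passes to the limit, which belongs to
  \<open>S\<close>.\<close>

lemma X_tendsto: "X \<longlonglongrightarrow> metric_proj S x"
proof -
  obtain l where l: "X \<longlonglongrightarrow> l" by (rule X_convergent)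
  have "metric_proj S x = l"
  proof (rule metric_proj_eqI[OF closed_convex_S limit_in_S[OF l]])
    fix z assume z: "z \<in> S"
    have "norm (x - X n) \<le> norm (x - z)" if "n \<ge> 1" for n
      using metric_proj_arg_min(2)[OF closed_convex_D[OF that] D_nonempty[OF that]]
        S_subset_D[OF that] z X_eq_proj[OF that] by auto
    then show "norm (x - l) \<le> norm (x - z)"
      by (intro LIMSEQ_le_const2[OF tendsto_norm[OF tendsto_diff[OF tendsto_const l]]]) auto
  qed
  then show ?thesis using l by simp
qed

end

section \<open>Existence of a run and assembly of the result\<close>

lemma hilbert_algorithm_exists:
  "\<exists>X Z U Y D. hilbert_algorithm C \<Theta> A T \<tau>\<Theta> \<tau>A \<tau>T \<alpha>1 \<alpha>2 \<alpha>3 r x X Z U Y D"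
proof -
  define z where "z n v = EP_resolvent C (\<Theta> (\<tau>\<Theta> n)) (r n) v" for n v
  define u where "u n v = VI_resolvent C (A (\<tau>A n)) (r n) v" for n v
  define y where "y n v = \<alpha>1 *\<^sub>R v + \<alpha>2 *\<^sub>R z n v + \<alpha>3 *\<^sub>R T (\<tau>T n) (u n v)" for n v
  define d where "d n v E = {w \<in> E. norm (w - y n v) \<le> norm (w - v)}" for n v E
  \<comment> \<open>The pair \<open>(X, D)\<close> determines the next pair, so primitive recursion
    suffices. State \<open>m\<close> holds the pair of index \<open>m + 1\<close>, because the
    algorithm starts at 1.\<close>
  define st where "st = rec_nat (x, C)
    (\<lambda>m (v, E). (metric_proj (d (Suc m) v E) x, d (Suc m) v E))"
  define X where "X n = fst (st (n - 1))" for n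
  define D where "D n = snd (st (n - 1))" for n
  have st_Suc: "st (Suc m) = (metric_proj (d (Suc m) (fst (st m)) (snd (st m))) x,
      d (Suc m) (fst (st m)) (snd (st m)))" for m
    by (simp add: st_def case_prod_unfold)
  have "X 1 = x" "D 1 = C" by (simp_all add: X_def D_def st_def)
  moreover have "D (Suc n) = d n (X n) (D n)" "X (Suc n) = metric_proj (D (Suc n)) x" if "n \<ge> 1" for n
    using that st_Suc[of "n - 1"] by (simp_all add: X_def D_def)
  ultimately have "hilbert_algorithm C \<Theta> A T \<tau>\<Theta> \<tau>A \<tau>T \<alpha>1 \<alpha>2 \<alpha>3 r x X
      (\<lambda>n. z n (X n)) (\<lambda>n. u n (X n)) (\<lambda>n. y n (X n)) D"
    by (simp add: hilbert_algorithm_def z_def u_def y_def d_def)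
  then show ?thesis by blast
qed

theorem corollary3p4:
  fixes C S :: "'a::{real_inner, complete_space} set"
    and \<Theta> :: "nat \<Rightarrow> 'a \<Rightarrow> 'a \<Rightarrow> real"
    and A T :: "nat \<Rightarrow> 'a \<Rightarrow> 'a"
    and \<tau>\<Theta> \<tau>A \<tau>T :: "nat \<Rightarrow> nat"
    and \<alpha>1 \<alpha>2 \<alpha>3 r0 :: real
    and r :: "nat \<Rightarrow> real"
    and x :: 'a
  assumes "C \<noteq> {}" "closed C" "convex C"
    and "\<And>l. l \<ge> 1 \<Longrightarrow> equilibrium_bifunction C (\<Theta> l)"
    and "\<And>k. k \<ge> 1 \<Longrightarrow> continuous_on C (A k)"
    and "\<And>k. k \<ge> 1 \<Longrightarrow> monotone_operator C (A k)"
    and "\<And>j. j \<ge> 1 \<Longrightarrow> J_closed C (T j)"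
    and "\<And>j. j \<ge> 1 \<Longrightarrow> bregman_nonexpansive C (T j)"
    and "\<And>l v s. l \<ge> 1 \<Longrightarrow> v \<in> C \<Longrightarrow> s > 0 \<Longrightarrow> EP_resolvent_set C (\<Theta> l) s v \<noteq> {}"
    and "\<And>k v s. k \<ge> 1 \<Longrightarrow> v \<in> C \<Longrightarrow> s > 0 \<Longrightarrow> VI_resolvent_set C (A k) s v \<noteq> {}"
    and "S = (\<Inter>j\<in>{1..}. fixed_points C (T j)) \<inter> (\<Inter>l\<in>{1..}. EP C (\<Theta> l)) \<inter>
             (\<Inter>k\<in>{1..}. VI C (A k))"
    and "S \<noteq> {}"
    and "\<alpha>1 \<in> {0<..<1}" "\<alpha>2 \<in> {0<..<1}" "\<alpha>3 \<in> {0<..<1}" "\<alpha>1 + \<alpha>2 + \<alpha>3 = 1"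
    and "r0 > 0" "\<And>n. n \<ge> 1 \<Longrightarrow> r n \<ge> r0"
    and "takes_all_values_infinitely_often \<tau>T"
    and "takes_all_values_infinitely_often \<tau>A"
    and "takes_all_values_infinitely_often \<tau>\<Theta>"
    and "x \<in> C"
  shows
    \<comment> \<open>\<open>J = J\<^sub>* = I\<close>, \<open>\<nabla>g = I\<close> and \<open>D\<^sub>g\<close>, under the Riesz identification\<close>
    "(\<forall>v::'a. duality_map v = {riesz v}) \<and>
     (\<forall>v::'a. inv_duality_map (riesz v) = v) \<and>
     (\<forall>f::'a \<Rightarrow>\<^sub>L real. riesz (inv_duality_map f) = f) \<and>
     (\<forall>v::'a. grad half_norm_sq v = riesz v) \<and>
     (\<forall>v w::'a. bregman_dist half_norm_sq v w = (norm (v - w))\<^sup>2 / 2) \<and>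
     \<comment> \<open>the general algorithm becomes the Hilbert space algorithm\<close>
     (\<forall>X Z U Y D.
        bregman_algorithm half_norm_sq C \<Theta> A (\<lambda>j v. riesz (T j v)) \<tau>\<Theta> \<tau>A \<tau>T \<alpha>1 \<alpha>2 \<alpha>3 r x X Z U Y D
        \<longleftrightarrow> hilbert_algorithm C \<Theta> A T \<tau>\<Theta> \<tau>A \<tau>T \<alpha>1 \<alpha>2 \<alpha>3 r x X Z U Y D) \<and>
     \<comment> \<open>it is well defined: the resolvents and projections used in it exist and are unique\<close>
     (\<exists>X Z U Y D. hilbert_algorithm C \<Theta> A T \<tau>\<Theta> \<tau>A \<tau>T \<alpha>1 \<alpha>2 \<alpha>3 r x X Z U Y D) \<and>
     (\<forall>X Z U Y D. hilbert_algorithm C \<Theta> A T \<tau>\<Theta> \<tau>A \<tau>T \<alpha>1 \<alpha>2 \<alpha>3 r x X Z U Y D \<longrightarrow>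
        (\<forall>n\<ge>1. X n \<in> C \<and>
           (\<exists>!z. z \<in> EP_resolvent_set C (\<Theta> (\<tau>\<Theta> n)) (r n) (X n)) \<and>
           (\<exists>!u. u \<in> VI_resolvent_set C (A (\<tau>A n)) (r n) (X n)) \<and>
           D n \<noteq> {} \<and> closed (D n) \<and> convex (D n))) \<and>
     closed S \<and> convex S \<and>
     \<comment> \<open>strong convergence\<close>
     (\<forall>X Z U Y D. hilbert_algorithm C \<Theta> A T \<tau>\<Theta> \<tau>A \<tau>T \<alpha>1 \<alpha>2 \<alpha>3 r x X Z U Y D \<longrightarrow>
        X \<longlonglongrightarrow> metric_proj S x)"
proof -
  define \<Phi> where "\<Phi> k = VI_bifunction (A k)" for k
  have \<Phi>: "equilibrium_bifunction C (\<Phi> k)" if "k \<ge> 1" for k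
    unfolding \<Phi>_def using assms(3,5,6) that by (intro equilibrium_bifunction_VI)
  have \<alpha>: "\<alpha>1 > 0" "\<alpha>2 > 0" "\<alpha>3 > 0" using assms(13-15) by auto
  have hybrid: "hybrid_projection C \<Theta> \<Phi> T \<tau>\<Theta> \<tau>A \<tau>T \<alpha>1 \<alpha>2 \<alpha>3 r0 r x X Z U Y D S"
    if alg: "hilbert_algorithm C \<Theta> A T \<tau>\<Theta> \<tau>A \<tau>T \<alpha>1 \<alpha>2 \<alpha>3 r x X Z U Y D" for X Z U Y D
  proof
    show "EP_resolvent_set C (\<Phi> k) s v \<noteq> {}" if "k \<ge> 1" "v \<in> C" "s > 0" for k v s
      using assms(10)[OF that] by (simp add: \<Phi>_def VI_resolvent_set_eq)
    show "S = (\<Inter>j\<in>{1..}. fixed_points C (T j)) \<inter> (\<Inter>l\<in>{1..}. EP C (\<Theta> l)) \<inter>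
        (\<Inter>l\<in>{1..}. EP C (\<Phi> l))"
      using assms(11) by (simp add: \<Phi>_def VI_eq_EP)
    show "U n = EP_resolvent C (\<Phi> (\<tau>A n)) (r n) (X n)" if "n \<ge> 1" for n
      using alg that
      by (simp add: hilbert_algorithm_def \<Phi>_def VI_resolvent_eq)
  qed ((rule assms \<alpha> \<Phi>; assumption) | (use alg[unfolded hilbert_algorithm_def] in blast))+
  have wf: "X n \<in> C \<and>
      (\<exists>!z. z \<in> EP_resolvent_set C (\<Theta> (\<tau>\<Theta> n)) (r n) (X n)) \<and>
      (\<exists>!u. u \<in> VI_resolvent_set C (A (\<tau>A n)) (r n) (X n)) \<and>
      D n \<noteq> {} \<and> closed (D n) \<and> convex (D n)"
    if alg: "hilbert_algorithm C \<Theta> A T \<tau>\<Theta> \<tau>A \<tau>T \<alpha>1 \<alpha>2 \<alpha>3 r x X Z U Y D" and n: "n \<ge> 1"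
    for X Z U Y D n
  proof -
    interpret hybrid_projection C \<Theta> \<Phi> T \<tau>\<Theta> \<tau>A \<tau>T \<alpha>1 \<alpha>2 \<alpha>3 r0 r x X Z U Y D S
      by (rule hybrid[OF alg])
    show ?thesis
      using X_in_C[OF n] resolvents_ex1[OF n X_in_C[OF n]] D_nonempty[OF n] closed_convex_D[OF n]
      unfolding VI_resolvent_set_eq \<Phi>_def by blast
  qed
  have conv: "X \<longlonglongrightarrow> metric_proj S x"
    if "hilbert_algorithm C \<Theta> A T \<tau>\<Theta> \<tau>A \<tau>T \<alpha>1 \<alpha>2 \<alpha>3 r x X Z U Y D" for X Z U Y D
    by (rule hybrid_projection.X_tendsto[OF hybrid[OF that]])
  have ex: "\<exists>X Z U Y D. hilbert_algorithm C \<Theta> A T \<tau>\<Theta> \<tau>A \<tau>T \<alpha>1 \<alpha>2 \<alpha>3 r x X Z U Y D"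
    by (rule hilbert_algorithm_exists)
  \<comment> \<open>These facts about \<open>S\<close> do not mention a run, but the locale requires
    one, supplied by \<open>ex\<close>.\<close>
  then have S: "closed S" "convex S"
    using hybrid_projection.closed_convex_S[OF hybrid] by blast+
  have inv: "riesz (inv_duality_map f) = f" for f :: "'a \<Rightarrow>\<^sub>L real"
    using riesz_surj[of f] inv_duality_map_riesz by metis
  show ?thesis
    by (intro conjI allI impI duality_map_hilbert inv_duality_map_riesz inv grad_half_norm_sq
        bregman_dist_half_norm_sq bregman_algorithm_half_norm_sq ex S)
      (use wf conv in blast)+
qed

end
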